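(* Let $m\in\{1,2,3\}$ and $I=\{1,2,3\}\setminus\{m\}$. Let $(\boldsymbol u,p)$ be a solution of the $x_m$-invariant perturbation model $$\partial_t u_i=\frac1{Re}\nabla^2u_i-\sum_{j=1}^3u_j\partial_{x_j}u_i-\sum_{j=1}^3U_j\partial_{x_j}u_i-\sum_{j=1}^3u_j\partial_{x_j}U_i-\partial_{x_i}p+\sum_{j=1}^3F_{ij}u_j+d_i\quad(i=1,2,3),\qquad \sum_{j=1}^3\partial_{x_j}u_j=0,$$ on $\Omega$, subject to periodic or no-slip ($\boldsymbol u|_{\partial\Omega}=0$) boundary conditions. Let $k_1,k_2,k_3>0$ be constants with $k_i=k_j$ for $i,j\in I$, and let $$V(\boldsymbol u)=\frac12\iint_\Omega\sum_{i=1}^3k_i\,u_i(t,\mathrm x)^2\,\mathrm d\Omega .$$ Then, for all $t>0$, $$\partial_tV(\boldsymbol u)\le-\sum_{i=1}^3k_i\iint_\Omega\Big(\frac{C(\Omega)}{Re}u_i^2+\sum_{j=1}^3U_ju_i\partial_{x_j}u_i+\sum_{j=1}^3u_ju_i\partial_{x_j}U_i-\sum_{j=1}^3u_iF_{ij}u_j-u_id_i\Big)\mathrm d\Omega,$$ where $C(\Omega)>0$ is the Poincaré constant of $\Omega$ given in the context.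
   Context: Setting. $Re>0$ is the Reynolds number and $F=(F_{ij})\in\mathbb R^{3\times3}$ is a constant matrix. All fields depend on $t$ and on the two coordinates $x_i$, $i\in I$, only (invariance in $x_m$: $\partial_{x_m}=0$ for every field). With $I=\{i,j\}$, the spatial variable is $\mathrm x=(x_i,x_j)\in\Omega=\Omega_i\times\Omega_j\subset\mathbb R\times\mathbb R$, a product of bounded open intervals; $\nabla$ and $\nabla^2$ are the gradient and Laplacian in these variables. $\boldsymbol d=(d_1,d_2,d_3)'$ is the input (body force). $(\boldsymbol U,P)$, with $\boldsymbol U=(U_1,U_2,U_3)'$, is an $x_m$-invariant stationary flow: $$0=\tfrac1{Re}\nabla^2\boldsymbol U-\boldsymbol U\cdot\nabla\boldsymbol U-\nabla P+F\boldsymbol U,\qquad \nabla\cdot\boldsymbol U=0.$$ $\boldsymbol u=(u_1,u_2,u_3)'$ and $p$ are the velocity and pressure perturbations from $(\boldsymbol U,P)$. All fields are assumed sufficiently smooth on $\overline\Omega$. In the periodic case $\Omega$ is a period cell, $\boldsymbol u$ and $p$ are periodic, and $\iint_\Omega\boldsymbol u\,\mathrm d\Omega=0$ for all $t$. Poincaré constant: $C(\Omega)=\pi^2/D(\Omega)^2$, where $D(\Omega)$ is the diameter of $\Omega$. *)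

theory Defs
  imports "HOL-Analysis.Analysis"
begin

text \<open>
  Vector components and coordinate axes are indexed by the three-element type \<open>3\<close>, whose
  elements are \<open>1\<close>, \<open>2\<close> and \<open>3 = 0\<close>. A field that is invariant in \<open>x\<^sub>m\<close> is a function of
  \<open>(x\<^sub>i, x\<^sub>j)\<close>, where \<open>{i, j}\<close> is the complement of \<open>{m}\<close>; the parameters \<open>i j\<close> below say
  which axes the two real coordinates belong to. Time-dependent fields take \<open>t\<close> first.
\<close>

text \<open>
  The unit vector of axis \<open>l\<close>, projected to the \<open>(x\<^sub>i, x\<^sub>j)\<close> plane. It vanishes for \<open>l = m\<close>,
  so that \<open>pd i j m f x = 0\<close>.
\<close>
definition axis_dir :: "3 \<Rightarrow> 3 \<Rightarrow> 3 \<Rightarrow> real \<times> real" where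
  "axis_dir i j l = (of_bool (l = i), of_bool (l = j))"

definition pd :: "3 \<Rightarrow> 3 \<Rightarrow> 3 \<Rightarrow> (real \<times> real \<Rightarrow> real) \<Rightarrow> real \<times> real \<Rightarrow> real" where
  "pd i j l f x = deriv (\<lambda>s. f (x + s *\<^sub>R axis_dir i j l)) 0"

definition laplacian :: "3 \<Rightarrow> 3 \<Rightarrow> (real \<times> real \<Rightarrow> real) \<Rightarrow> real \<times> real \<Rightarrow> real" where
  "laplacian i j f x = pd i j i (pd i j i f) x + pd i j j (pd i j j f) x"

definition extends_to_closure ::
  "(real \<times> real) set \<Rightarrow> (real \<Rightarrow> real \<times> real \<Rightarrow> real) \<Rightarrow> bool" where
  "extends_to_closure \<Omega> f \<longleftrightarrow>
     (\<exists>g. continuous_on ({0<..} \<times> closure \<Omega>) g \<and> (\<forall>t>0. \<forall>x\<in>\<Omega>. g (t, x) = f t x))"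

text \<open>
  \<open>C\<^sup>n\<close> in space up to the boundary: for an open set \<open>\<Omega>\<close>, all spatial partial derivatives of
  order at most \<open>n\<close> exist on \<open>\<Omega>\<close> and extend to functions on the closure of \<open>\<Omega>\<close> that are
  continuous jointly in \<open>(t, x)\<close>, \<open>t > 0\<close>.
\<close>
primrec Ck_closure ::
  "nat \<Rightarrow> 3 \<Rightarrow> 3 \<Rightarrow> (real \<times> real) set \<Rightarrow> (real \<Rightarrow> real \<times> real \<Rightarrow> real) \<Rightarrow> bool" where
  "Ck_closure 0 i j \<Omega> f \<longleftrightarrow> extends_to_closure \<Omega> f"
| "Ck_closure (Suc n) i j \<Omega> f \<longleftrightarrow>
     extends_to_closure \<Omega> f \<and>
     (\<forall>l. (\<forall>t>0. \<forall>x\<in>\<Omega>. (\<lambda>s. f t (x + s *\<^sub>R axis_dir i j l)) field_differentiable at 0) \<and>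
          Ck_closure n i j \<Omega> (\<lambda>t. pd i j l (f t)))"

definition smooth_perturbation ::
  "3 \<Rightarrow> 3 \<Rightarrow> (real \<times> real) set \<Rightarrow> (real \<Rightarrow> real \<times> real \<Rightarrow> real^3) \<Rightarrow>
   (real \<Rightarrow> real \<times> real \<Rightarrow> real) \<Rightarrow> bool" where
  "smooth_perturbation i j \<Omega> u p \<longleftrightarrow>
     (\<forall>l. Ck_closure 2 i j \<Omega> (\<lambda>t x. u t x $ l) \<and>
          (\<forall>t>0. \<forall>x\<in>\<Omega>. (\<lambda>s. u s x $ l) field_differentiable at t) \<and>
          extends_to_closure \<Omega> (\<lambda>t x. deriv (\<lambda>s. u s x $ l) t)) \<and>
     Ck_closure 1 i j \<Omega> p"

definition smooth_base_flow ::
  "3 \<Rightarrow> 3 \<Rightarrow> (real \<times> real) set \<Rightarrow> (real \<times> real \<Rightarrow> real^3) \<Rightarrow> (real \<times> real \<Rightarrow> real) \<Rightarrow> bool" where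
  "smooth_base_flow i j \<Omega> U P \<longleftrightarrow>
     (\<forall>l. Ck_closure 2 i j \<Omega> (\<lambda>t x. U x $ l)) \<and> Ck_closure 1 i j \<Omega> (\<lambda>t. P)"

definition stationary_flow ::
  "real \<Rightarrow> real^3^3 \<Rightarrow> 3 \<Rightarrow> 3 \<Rightarrow> (real \<times> real) set \<Rightarrow>
   (real \<times> real \<Rightarrow> real^3) \<Rightarrow> (real \<times> real \<Rightarrow> real) \<Rightarrow> bool" where
  "stationary_flow Rey F i j \<Omega> U P \<longleftrightarrow>
     (\<forall>x\<in>\<Omega>.
        (\<forall>l. 0 = 1 / Rey * laplacian i j (\<lambda>y. U y $ l) x
                 - (\<Sum>n\<in>UNIV. U x $ n * pd i j n (\<lambda>y. U y $ l) x)
                 - pd i j l P x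
                 + (\<Sum>n\<in>UNIV. F $ l $ n * U x $ n)) \<and>
        (\<Sum>n\<in>UNIV. pd i j n (\<lambda>y. U y $ n) x) = 0)"

definition perturbation_model ::
  "real \<Rightarrow> real^3^3 \<Rightarrow> (real \<times> real \<Rightarrow> real^3) \<Rightarrow> (real \<Rightarrow> real \<times> real \<Rightarrow> real^3) \<Rightarrow>
   3 \<Rightarrow> 3 \<Rightarrow> (real \<times> real) set \<Rightarrow>
   (real \<Rightarrow> real \<times> real \<Rightarrow> real^3) \<Rightarrow> (real \<Rightarrow> real \<times> real \<Rightarrow> real) \<Rightarrow> bool" where
  "perturbation_model Rey F U d i j \<Omega> u p \<longleftrightarrow>
     (\<forall>t>0. \<forall>x\<in>\<Omega>.
        (\<forall>l. deriv (\<lambda>s. u s x $ l) t =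
               1 / Rey * laplacian i j (\<lambda>y. u t y $ l) x
               - (\<Sum>n\<in>UNIV. u t x $ n * pd i j n (\<lambda>y. u t y $ l) x)
               - (\<Sum>n\<in>UNIV. U x $ n * pd i j n (\<lambda>y. u t y $ l) x)
               - (\<Sum>n\<in>UNIV. u t x $ n * pd i j n (\<lambda>y. U y $ l) x)
               - pd i j l (p t) x
               + (\<Sum>n\<in>UNIV. F $ l $ n * u t x $ n)
               + d t x $ l) \<and>
        (\<Sum>n\<in>UNIV. pd i j n (\<lambda>y. u t y $ n) x) = 0)"

text \<open>
  The continuity clause makes the values of \<open>u\<close> on the boundary the limits of its values
  inside \<open>\<Omega>\<close>; \<^const>\<open>smooth_perturbation\<close> constrains the values inside only.
\<close>
definition no_slip :: "(real \<times> real) set \<Rightarrow> (real \<Rightarrow> real \<times> real \<Rightarrow> real^3) \<Rightarrow> bool" where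
  "no_slip \<Omega> u \<longleftrightarrow>
     continuous_on ({0<..} \<times> closure \<Omega>) (\<lambda>(t, x). u t x) \<and>
     (\<forall>t>0. \<forall>x\<in>frontier \<Omega>. u t x = 0)"

text \<open>
  Periodicity with periods \<open>L\<^sub>i\<close>, \<open>L\<^sub>j\<close>, the side lengths of the cell \<open>\<Omega>\<close>, and zero mean.
\<close>
definition periodic_zero_mean ::
  "real \<Rightarrow> real \<Rightarrow> (real \<times> real) set \<Rightarrow> (real \<Rightarrow> real \<times> real \<Rightarrow> real^3) \<Rightarrow>
   (real \<Rightarrow> real \<times> real \<Rightarrow> real) \<Rightarrow> bool" where
  "periodic_zero_mean L\<^sub>i L\<^sub>j \<Omega> u p \<longleftrightarrow>
     (\<forall>t>0.
        (\<forall>x. u t (x + (L\<^sub>i, 0)) = u t x \<and> u t (x + (0, L\<^sub>j)) = u t x \<and>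
             p t (x + (L\<^sub>i, 0)) = p t x \<and> p t (x + (0, L\<^sub>j)) = p t x) \<and>
        (LINT x:\<Omega>|lborel. u t x) = 0)"

definition poincare_const :: "(real \<times> real) set \<Rightarrow> real" where
  "poincare_const \<Omega> = pi^2 / (diameter \<Omega>)^2"

definition energy :: "real^3 \<Rightarrow> (real \<times> real) set \<Rightarrow> (real \<times> real \<Rightarrow> real^3) \<Rightarrow> real" where
  "energy k \<Omega> v = 1/2 * (LINT x:\<Omega>|lborel. (\<Sum>l\<in>UNIV. k $ l * (v x $ l)^2))"

end

theory Submission
  imports Defs
begin

text \<open>
  Multiply the \<open>l\<close>-th momentum equation by \<open>k\<^sub>l u\<^sub>l\<close> and integrate. Since \<open>u\<close> is divergence free,
  \<open>u\<^sub>l u \<cdot> \<nabla> u\<^sub>l\<close> is the divergence of \<open>u\<^sub>l\<^sup>2 u / 2\<close> and \<open>u \<cdot> \<nabla> p\<close> that of \<open>p u\<close>; both integrate to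
  zero under either boundary condition (the pressure term because \<open>k\<^sub>i = k\<^sub>j\<close> and \<open>p\<close> does not depend
  on \<open>x\<^sub>m\<close>). The viscous term becomes \<open>- |\<nabla> u\<^sub>l|\<^sup>2 / Rey\<close>, which the Poincare inequality bounds.
  The constant \<open>pi\<^sup>2 / D\<^sup>2\<close> is not sharp on a rectangle: the diameter \<open>D\<close> exceeds both side lengths,
  so one-dimensional Wirtinger inequalities along the axes suffice.
\<close>

section \<open>One-dimensional Wirtinger inequalities\<close>

text \<open>
  Picone's argument: the cosine with half period \<open>D\<close> centred on the interval is positive up to
  the end points because \<open>b - a < D\<close>; \<open>q\<close> below is minus its logarithmic derivative, and
  \<open>(f' + f q)\<^sup>2 \<ge> 0\<close> bounds \<open>f'\<^sup>2 - (pi / D)\<^sup>2 f\<^sup>2\<close> below by the exact derivative \<open>- (f\<^sup>2 q)'\<close>.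
\<close>

lemma wirtinger_dirichlet:
  fixes f f' :: "real \<Rightarrow> real"
  assumes "a < b" "b - a < D"
    and cf: "continuous_on {a..b} f" and cf': "continuous_on {a..b} f'"
    and der: "\<And>x. x \<in> {a<..<b} \<Longrightarrow> (f has_real_derivative f' x) (at x)"
    and "f a = 0" "f b = 0"
  shows "(pi / D)^2 * integral {a..b} (\<lambda>x. (f x)^2) \<le> integral {a..b} (\<lambda>x. (f' x)^2)"
proof -
  define w where "w = pi / D"
  define c where "c = (a + b) / 2"
  have D: "D > 0" using assms by simp
  have w: "w > 0" using D by (simp add: w_def)
  have cos: "cos (w * (x - c)) > 0" if "x \<in> {a..b}" for x
  proof -
    have "\<bar>x - c\<bar> \<le> (b - a) / 2"
      using that by (auto simp: c_def abs_le_iff field_simps)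
    then have "\<bar>x - c\<bar> < D / 2" using assms(2) by simp
    then have "w * \<bar>x - c\<bar> < w * (D / 2)" using w by simp
    also have "w * (D / 2) = pi / 2" using D by (simp add: w_def)
    finally have "\<bar>w * (x - c)\<bar> < pi / 2" using w by (simp add: abs_mult)
    then show ?thesis by (intro cos_gt_zero_pi) (auto simp: abs_less_iff)
  qed
  define q where "q x = w * tan (w * (x - c))" for x
  \<comment> \<open>Since \<open>q\<close> solves the Riccati equation
    \<open>q' = w^2 + q^2\<close>, \<open>h\<close> is the derivative of \<open>f^2 q\<close>, and
    \<open>(f')^2 - w^2 f^2 + h\<close> is the square \<open>(f' + f q)^2\<close>. The integral of
    \<open>h\<close> vanishes because \<open>f\<close> does at both ends.\<close>
  define h where "h x = 2 * f x * f' x * q x + (f x)^2 * (w^2 + (q x)^2)" for x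
  have cq: "continuous_on {a..b} q"
    unfolding q_def using cos by (intro continuous_intros) (auto simp: less_imp_neq[symmetric])
  have "(h has_integral ((f b)^2 * q b - (f a)^2 * q a)) {a..b}"
  proof (rule fundamental_theorem_of_calculus_interior)
    show "continuous_on {a..b} (\<lambda>x. (f x)^2 * q x)"
      by (intro continuous_intros cf cq)
    fix x assume x: "x \<in> {a<..<b}"
    then have nz: "cos (w * (x - c)) \<noteq> 0" using cos[of x] by auto
    have sec: "inverse ((cos (w * (x - c)))^2) = 1 + (tan (w * (x - c)))^2"
      using tan_sec[OF nz] by (simp add: power_inverse)
    have "(q has_real_derivative (w * (inverse ((cos (w * (x - c)))^2) * w))) (at x)"
      unfolding q_def using nz by (auto intro!: derivative_eq_intros)
    then have "(q has_real_derivative (w^2 + (q x)^2)) (at x)"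
      unfolding sec q_def by (simp add: power2_eq_square distrib_left distrib_right mult_ac)
    then have "((\<lambda>x. (f x)^2 * q x) has_real_derivative h x) (at x)"
      unfolding h_def by (auto intro!: derivative_eq_intros der[OF x])
    then show "((\<lambda>x. (f x)^2 * q x) has_vector_derivative h x) (at x)"
      by (simp add: has_real_derivative_iff_has_vector_derivative)
  qed (use assms in auto)
  then have h: "h integrable_on {a..b}" "integral {a..b} h = 0"
    using assms by (auto simp: has_integral_iff)
  have i1: "(\<lambda>x. (f x)^2) integrable_on {a..b}" and i2: "(\<lambda>x. (f' x)^2) integrable_on {a..b}"
    by (intro integrable_continuous_real continuous_intros cf cf')+
  have "w^2 * integral {a..b} (\<lambda>x. (f x)^2) = integral {a..b} (\<lambda>x. w^2 * (f x)^2 - h x)"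
    using i1 h by (subst integral_diff) (auto intro: integrable_on_mult_right)
  also have "\<dots> \<le> integral {a..b} (\<lambda>x. (f' x)^2)"
  proof (rule integral_le)
    show "(\<lambda>x. w^2 * (f x)^2 - h x) integrable_on {a..b}"
      by (intro integrable_diff integrable_on_mult_right i1 h)
    fix x
    have "0 \<le> (f' x + f x * q x)^2" by simp
    then show "w^2 * (f x)^2 - h x \<le> (f' x)^2"
      by (simp add: h_def power2_eq_square algebra_simps)
  qed (rule i2)
  finally show ?thesis by (simp add: w_def)
qed

lemma integral_square_shift:
  fixes f :: "real \<Rightarrow> real"
  assumes "a < b" and cf: "continuous_on {a..b} f"
  shows "integral {a..b} (\<lambda>x. (f x - c)^2)
    = integral {a..b} (\<lambda>x. (f x)^2) - 2 * c * integral {a..b} f + (b - a) * c^2"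
proof -
  have i: "(\<lambda>x. (f x)^2) integrable_on {a..b}" "f integrable_on {a..b}"
    by (intro integrable_continuous_real continuous_intros cf)+
  have "integral {a..b} (\<lambda>x. (f x - c)^2) = integral {a..b} (\<lambda>x. (f x)^2 - 2 * c * f x + c^2)"
    by (simp add: power2_diff algebra_simps)
  also have "\<dots> = integral {a..b} (\<lambda>x. (f x)^2) - 2 * c * integral {a..b} f + (b - a) * c^2"
  proof (rule integral_unique)
    show "((\<lambda>x. (f x)^2 - 2 * c * f x + c^2) has_integral
        integral {a..b} (\<lambda>x. (f x)^2) - 2 * c * integral {a..b} f + (b - a) * c^2) {a..b}"
      using has_integral_const_real[of "c^2" a b] assms i
      by (intro has_integral_add has_integral_diff has_integral_mult_right integrable_integral) auto
  qed
  finally show ?thesis .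
qed

text \<open>Cauchy-Schwarz against the constant 1, read off from the nonnegative integral of
  \<open>(f - c)^2\<close> with \<open>c\<close> the mean of \<open>f\<close>.\<close>

lemma square_integral_le:
  fixes f :: "real \<Rightarrow> real"
  assumes "a < b" and cf: "continuous_on {a..b} f"
  shows "(integral {a..b} f)^2 \<le> (b - a) * integral {a..b} (\<lambda>x. (f x)^2)"
proof -
  define c where "c = integral {a..b} f / (b - a)"
  have I: "integral {a..b} f = (b - a) * c" using assms by (simp add: c_def)
  have "0 \<le> integral {a..b} (\<lambda>x. (f x - c)^2)"
    by (intro integral_nonneg integrable_continuous_real continuous_intros cf) auto
  also have "\<dots> = integral {a..b} (\<lambda>x. (f x)^2) - (b - a) * c^2"
    unfolding integral_square_shift[OF assms] I by (simp add: power2_eq_square algebra_simps)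
  finally have "(b - a) * ((b - a) * c^2) \<le> (b - a) * integral {a..b} (\<lambda>x. (f x)^2)"
    using assms by (intro mult_left_mono) auto
  then show ?thesis by (simp add: I power2_eq_square algebra_simps)
qed

text \<open>As \<open>f a = f b\<close>, the function \<open>f - f a\<close> vanishes at both ends
  and falls under the Dirichlet case. Among all constants the mean is the closest to
  \<open>f\<close> in the square integral, so the left side only grows when the mean is replaced by
  \<open>f a\<close>.\<close>

lemma wirtinger_periodic:
  fixes f f' :: "real \<Rightarrow> real"
  assumes ab: "a < b" "b - a < D"
    and cf: "continuous_on {a..b} f" and cf': "continuous_on {a..b} f'"
    and der: "\<And>x. x \<in> {a<..<b} \<Longrightarrow> (f has_real_derivative f' x) (at x)"
    and "f a = f b"
  shows "(pi / D)^2 * (integral {a..b} (\<lambda>x. (f x)^2) - (integral {a..b} f)^2 / (b - a))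
    \<le> integral {a..b} (\<lambda>x. (f' x)^2)"
proof -
  have "0 \<le> (integral {a..b} f - (b - a) * f a)^2 / (b - a)" using ab by simp
  also have "\<dots> = (integral {a..b} f)^2 / (b - a) - 2 * f a * integral {a..b} f + (b - a) * (f a)^2"
    using ab by (simp add: power2_eq_square field_simps)
  finally have "(pi / D)^2 * (integral {a..b} (\<lambda>x. (f x)^2) - (integral {a..b} f)^2 / (b - a))
      \<le> (pi / D)^2 * integral {a..b} (\<lambda>x. (f x - f a)^2)"
    unfolding integral_square_shift[OF ab(1) cf] by (intro mult_left_mono) auto
  also have "\<dots> \<le> integral {a..b} (\<lambda>x. (f' x)^2)"
    using assms by (intro wirtinger_dirichlet) (auto intro!: continuous_intros derivative_eq_intros)
  finally show ?thesis .
qed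

section \<open>Iterated integrals and Poincare inequalities on a closed rectangle\<close>

lemma integral_rect:
  fixes f :: "real \<times> real \<Rightarrow> real"
  assumes "continuous_on ({a..b} \<times> {c..d}) f"
  shows "integral ({a..b} \<times> {c..d}) f = integral {a..b} (\<lambda>x. integral {c..d} (\<lambda>y. f (x, y)))"
    and "integral ({a..b} \<times> {c..d}) f = integral {c..d} (\<lambda>y. integral {a..b} (\<lambda>x. f (x, y)))"
    and "continuous_on {a..b} (\<lambda>x. integral {c..d} (\<lambda>y. f (x, y)))"
    and "continuous_on {c..d} (\<lambda>y. integral {a..b} (\<lambda>x. f (x, y)))"
proof -
  have c: "continuous_on (cbox (a, c) (b, d)) f" using assms by (simp add: cbox_Pair_eq)
  show "integral ({a..b} \<times> {c..d}) f = integral {a..b} (\<lambda>x. integral {c..d} (\<lambda>y. f (x, y)))"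
    using integral_prod_continuous[OF c] by (simp add: cbox_Pair_eq)
  also have "\<dots> = integral {c..d} (\<lambda>y. integral {a..b} (\<lambda>x. f (x, y)))"
    using integral_swap_continuous[of a c b d "\<lambda>x y. f (x, y)"] c by simp
  finally show "integral ({a..b} \<times> {c..d}) f = integral {c..d} (\<lambda>y. integral {a..b} (\<lambda>x. f (x, y)))" .
  show "continuous_on {a..b} (\<lambda>x. integral {c..d} (\<lambda>y. f (x, y)))"
    using integral_continuous_on_param[of "{a..b}" c d "\<lambda>x y. f (x, y)"] assms by simp
  have "continuous_on ({c..d} \<times> {a..b}) (\<lambda>(y, x). f (x, y))"
    unfolding case_prod_unfold
    by (rule continuous_on_compose2[OF assms]) (auto intro!: continuous_intros)
  then show "continuous_on {c..d} (\<lambda>y. integral {a..b} (\<lambda>x. f (x, y)))"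
    using integral_continuous_on_param[of "{c..d}" a b "\<lambda>y x. f (x, y)"] by simp
qed

lemma continuous_on_slice:
  assumes "continuous_on ({a..b} \<times> {c..d}) f"
  shows "y \<in> {c..d} \<Longrightarrow> continuous_on {a..b} (\<lambda>x. f (x, y))"
    and "x \<in> {a..b} \<Longrightarrow> continuous_on {c..d} (\<lambda>y. f (x, y))"
  by (rule continuous_on_compose2[OF assms]; auto intro!: continuous_intros)+

lemma integral_le_interior:
  fixes f g :: "real \<Rightarrow> real"
  assumes "continuous_on {a..b} f" "continuous_on {a..b} g"
    and "\<And>x. x \<in> {a<..<b} \<Longrightarrow> f x \<le> g x"
  shows "integral {a..b} f \<le> integral {a..b} g"
proof -
  have "integral {a<..<b} f \<le> integral {a<..<b} g"
    by (intro integral_le) (use assms in \<open>auto simp: integrable_on_open_interval_real intro: integrable_continuous_real\<close>)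
  then show ?thesis by (simp add: integral_open_interval_real)
qed

lemma integral_eq_0_interior:
  fixes f :: "real \<Rightarrow> real"
  assumes "\<And>x. x \<in> {a<..<b} \<Longrightarrow> f x = 0"
  shows "integral {a..b} f = 0"
proof -
  have "integral {a<..<b} f = integral {a<..<b} (\<lambda>_. 0)"
    by (rule integral_cong) (use assms in auto)
  then show ?thesis by (simp add: integral_open_interval_real)
qed

text \<open>The one-dimensional Dirichlet inequality holds on each slice in \<open>x\<close>;
  integrating it over \<open>y\<close> gives the claim.\<close>

lemma poincare_rect_dirichlet:
  fixes f fx :: "real \<times> real \<Rightarrow> real"
  assumes ab: "a < b" "b - a < D"
    and cf: "continuous_on ({a..b} \<times> {c..d}) f" and cfx: "continuous_on ({a..b} \<times> {c..d}) fx"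
    and der: "\<And>x y. x \<in> {a<..<b} \<Longrightarrow> y \<in> {c<..<d} \<Longrightarrow>
      ((\<lambda>s. f (s, y)) has_real_derivative fx (x, y)) (at x)"
    and bc: "\<And>y. y \<in> {c..d} \<Longrightarrow> f (a, y) = 0 \<and> f (b, y) = 0"
  shows "(pi / D)^2 * integral ({a..b} \<times> {c..d}) (\<lambda>z. (f z)^2)
    \<le> integral ({a..b} \<times> {c..d}) (\<lambda>z. (fx z)^2)"
proof -
  have c: "continuous_on ({a..b} \<times> {c..d}) (\<lambda>z. (f z)^2)"
    "continuous_on ({a..b} \<times> {c..d}) (\<lambda>z. (fx z)^2)"
    by (intro continuous_intros cf cfx)+
  have "integral {c..d} (\<lambda>y. (pi / D)^2 * integral {a..b} (\<lambda>x. (f (x, y))^2))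
      \<le> integral {c..d} (\<lambda>y. integral {a..b} (\<lambda>x. (fx (x, y))^2))"
  proof (rule integral_le_interior)
    fix y assume y: "y \<in> {c<..<d}"
    then show "(pi / D)^2 * integral {a..b} (\<lambda>x. (f (x, y))^2) \<le> integral {a..b} (\<lambda>x. (fx (x, y))^2)"
      using ab bc[of y] der[of _ y] continuous_on_slice(1)[OF cf, of y] continuous_on_slice(1)[OF cfx, of y]
      by (intro wirtinger_dirichlet) auto
  qed (intro continuous_intros integral_rect(4)[OF c(1)] integral_rect(4)[OF c(2)])+
  then show ?thesis unfolding integral_rect(2)[OF c(1)] integral_rect(2)[OF c(2)] by simp
qed

text \<open>
  The one-dimensional inequality is applied to each slice in \<open>x\<close>, which leaves the slice means
  \<open>g y / (b - a)\<close>, and then to \<open>g\<close>, which has mean zero.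
\<close>

lemma poincare_rect_periodic:
  fixes f fx fy :: "real \<times> real \<Rightarrow> real"
  assumes ab: "a < b" "b - a < D" and cd: "c < d" "d - c < D"
    and cf: "continuous_on ({a..b} \<times> {c..d}) f" and cfx: "continuous_on ({a..b} \<times> {c..d}) fx"
    and cfy: "continuous_on ({a..b} \<times> {c..d}) fy"
    and derx: "\<And>x y. x \<in> {a<..<b} \<Longrightarrow> y \<in> {c<..<d} \<Longrightarrow>
      ((\<lambda>s. f (s, y)) has_real_derivative fx (x, y)) (at x)"
    and dery: "\<And>x y. x \<in> {a..b} \<Longrightarrow> y \<in> {c..d} \<Longrightarrow>
      ((\<lambda>s. f (x, s)) has_real_derivative fy (x, y)) (at y)"
    and bcx: "\<And>y. y \<in> {c..d} \<Longrightarrow> f (a, y) = f (b, y)"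
    and bcy: "\<And>x. x \<in> {a..b} \<Longrightarrow> f (x, c) = f (x, d)"
    and mean: "integral ({a..b} \<times> {c..d}) f = 0"
  shows "(pi / D)^2 * integral ({a..b} \<times> {c..d}) (\<lambda>z. (f z)^2)
    \<le> integral ({a..b} \<times> {c..d}) (\<lambda>z. (fx z)^2) + integral ({a..b} \<times> {c..d}) (\<lambda>z. (fy z)^2)"
proof -
  define g where "g y = integral {a..b} (\<lambda>x. f (x, y))" for y
  define g' where "g' y = integral {a..b} (\<lambda>x. fy (x, y))" for y
  note cfs = continuous_on_slice(1)[OF cf]
  have cg: "continuous_on {c..d} g" and cg': "continuous_on {c..d} g'"
    unfolding g_def g'_def by (intro integral_rect(4) cf cfy)+
  have c: "continuous_on ({a..b} \<times> {c..d}) (\<lambda>z. (f z)^2)"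
    "continuous_on ({a..b} \<times> {c..d}) (\<lambda>z. (fx z)^2)"
    "continuous_on ({a..b} \<times> {c..d}) (\<lambda>z. (fy z)^2)"
    by (intro continuous_intros cf cfx cfy)+
  note ci = integral_rect(4)[OF c(1)] integral_rect(4)[OF c(2)] integral_rect(4)[OF c(3)]
  have dg: "(g has_real_derivative g' y) (at y)" if y: "y \<in> {c<..<d}" for y
  proof -
    \<comment> \<open>The Leibniz rule asks for the \<open>y\<close> derivative at every point of
      the closed rectangle. This is why \<open>dery\<close> is assumed up to the boundary, whereas
      \<open>derx\<close> is assumed inside.\<close>
    have "(g has_real_derivative g' y) (at y within {c..d})"
      unfolding g_def g'_def interval_cbox
    proof (rule leibniz_rule_field_derivative)
      show "continuous_on (cbox c d \<times> cbox a b) (\<lambda>(y, x). fy (x, y))"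
        unfolding case_prod_unfold
        by (rule continuous_on_compose2[OF cfy]) (auto intro!: continuous_intros)
    qed (use y in \<open>auto intro!: dery[THEN has_field_derivative_at_within] integrable_continuous_real cfs\<close>)
    then show ?thesis using y by (simp add: at_within_Icc_at)
  qed
  have "integral {c..d} (\<lambda>y. (pi / D)^2 * (integral {a..b} (\<lambda>x. (f (x, y))^2) - (g y)^2 / (b - a)))
      \<le> integral {c..d} (\<lambda>y. integral {a..b} (\<lambda>x. (fx (x, y))^2))"
  proof (rule integral_le_interior)
    fix y assume y: "y \<in> {c<..<d}"
    then show "(pi / D)^2 * (integral {a..b} (\<lambda>x. (f (x, y))^2) - (g y)^2 / (b - a))
      \<le> integral {a..b} (\<lambda>x. (fx (x, y))^2)"
      using ab bcx[of y] derx[of _ y] cfs[of y] continuous_on_slice(1)[OF cfx, of y]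
      unfolding g_def by (intro wirtinger_periodic) auto
  qed (use ab in \<open>intro continuous_intros ci cg; simp\<close>)+
  moreover have "integral {c..d} (\<lambda>y. (pi / D)^2 * (integral {a..b} (\<lambda>x. (f (x, y))^2) - (g y)^2 / (b - a)))
     = (pi / D)^2 * (integral ({a..b} \<times> {c..d}) (\<lambda>z. (f z)^2) - integral {c..d} (\<lambda>y. (g y)^2) / (b - a))"
  proof -
    have "(\<lambda>y. (g y)^2 / (b - a)) integrable_on {c..d}"
      using ab by (intro integrable_continuous_real continuous_intros cg) auto
    then show ?thesis
      by (simp add: integral_rect(2)[OF c(1)] integral_diff integrable_continuous_real ci)
  qed
  ultimately have 1: "(pi / D)^2 * (integral ({a..b} \<times> {c..d}) (\<lambda>z. (f z)^2) - integral {c..d} (\<lambda>y. (g y)^2) / (b - a))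
      \<le> integral ({a..b} \<times> {c..d}) (\<lambda>z. (fx z)^2)"
    unfolding integral_rect(2)[OF c(2)] by argo
  have "integral {c..d} g = 0" using mean by (simp add: g_def[abs_def] integral_rect(2)[OF cf])
  moreover have "g c = g d" unfolding g_def by (rule integral_cong) (use bcy in auto)
  ultimately have "(pi / D)^2 * integral {c..d} (\<lambda>y. (g y)^2) \<le> integral {c..d} (\<lambda>y. (g' y)^2)"
    using wirtinger_periodic[OF cd cg cg' dg] by simp
  \<comment> \<open>Cauchy-Schwarz bounds \<open>(g' y)^2\<close> by the slice integral of
    \<open>fy^2\<close> at the price of a factor \<open>b - a\<close>, which cancels the division by
    \<open>b - a\<close> in the mean term of fact \<open>1\<close>.\<close>
  also have "\<dots> \<le> integral {c..d} (\<lambda>y. (b - a) * integral {a..b} (\<lambda>x. (fy (x, y))^2))"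
    unfolding g'_def
    by (intro integral_le_interior square_integral_le ab continuous_on_slice(1)[OF cfy]
        continuous_intros ci cg'[unfolded g'_def]) auto
  finally have "(pi / D)^2 * integral {c..d} (\<lambda>y. (g y)^2)
      \<le> (b - a) * integral ({a..b} \<times> {c..d}) (\<lambda>z. (fy z)^2)"
    by (simp add: integral_rect(2)[OF c(3)])
  then have 2: "(pi / D)^2 * (integral {c..d} (\<lambda>y. (g y)^2) / (b - a))
      \<le> integral ({a..b} \<times> {c..d}) (\<lambda>z. (fy z)^2)"
    using ab by (simp add: field_simps)
  show ?thesis using 1 2 by (simp add: right_diff_distrib)
qed

section \<open>Functions on a set with a continuous extension to its closure\<close>

text \<open>The fields and their derivatives are constrained only inside the domain, so continuity
  up to the boundary is a property of some extension; the values of \<open>f\<close> itself on the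
  boundary are left arbitrary.\<close>

definition extendable :: "'a::topological_space set \<Rightarrow> ('a \<Rightarrow> 'b::topological_space) \<Rightarrow> bool" where
  "extendable S f \<longleftrightarrow> (\<exists>g. continuous_on (closure S) g \<and> (\<forall>x\<in>S. g x = f x))"

lemma extendable_continuous: "continuous_on (closure S) f \<Longrightarrow> extendable S f"
  unfolding extendable_def by blast

lemma extendable_const: "extendable S (\<lambda>_. c)"
  by (rule extendable_continuous) (rule continuous_on_const)

lemma extendable_add:
  fixes f g :: "'a::topological_space \<Rightarrow> 'b::topological_monoid_add"
  assumes "extendable S f" "extendable S g"
  shows "extendable S (\<lambda>x. f x + g x)"
proof -
  obtain f' g' where "continuous_on (closure S) f'" "\<forall>x\<in>S. f' x = f x"
    "continuous_on (closure S) g'" "\<forall>x\<in>S. g' x = g x"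
    using assms unfolding extendable_def by blast
  then show ?thesis
    unfolding extendable_def by (intro exI[of _ "\<lambda>x. f' x + g' x"]) (auto intro: continuous_on_add)
qed

lemma extendable_mult:
  fixes f g :: "'a::topological_space \<Rightarrow> real"
  assumes "extendable S f" "extendable S g"
  shows "extendable S (\<lambda>x. f x * g x)"
proof -
  obtain f' g' where "continuous_on (closure S) f'" "\<forall>x\<in>S. f' x = f x"
    "continuous_on (closure S) g'" "\<forall>x\<in>S. g' x = g x"
    using assms unfolding extendable_def by blast
  then show ?thesis
    unfolding extendable_def by (intro exI[of _ "\<lambda>x. f' x * g' x"]) (auto intro: continuous_on_mult)
qed

lemma extendable_diff:
  fixes f g :: "'a::topological_space \<Rightarrow> real"
  assumes "extendable S f" "extendable S g"
  shows "extendable S (\<lambda>x. f x - g x)"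
  using extendable_add[OF assms(1) extendable_mult[OF extendable_const[of S "-1"] assms(2)]] by simp

lemma extendable_power2:
  fixes f :: "'a::topological_space \<Rightarrow> real"
  shows "extendable S f \<Longrightarrow> extendable S (\<lambda>x. (f x)^2)"
  unfolding power2_eq_square by (rule extendable_mult)

lemma extendable_sum:
  fixes f :: "'i \<Rightarrow> 'a::topological_space \<Rightarrow> real"
  assumes "\<And>n. n \<in> A \<Longrightarrow> extendable S (f n)"
  shows "extendable S (\<lambda>x. \<Sum>n\<in>A. f n x)"
  using assms
  by (induction A rule: infinite_finite_induct) (auto intro!: extendable_const extendable_add)

lemmas extendable_intros = extendable_const extendable_add extendable_mult extendable_diff extendable_power2 extendable_sum

text \<open>The extension is continuous on a compact rectangle, hence integrable, and the boundary
  is a null set. This is the passage from Lebesgue integrals over the open rectangle to iterated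
  integrals over the closed one.\<close>

lemma extendable_rect_integral:
  fixes f g :: "real \<times> real \<Rightarrow> 'b::euclidean_space"
  assumes "continuous_on ({a..b} \<times> {c..d}) g"
    and "\<And>z. z \<in> {a<..<b} \<times> {c<..<d} \<Longrightarrow> g z = f z"
  shows "set_integrable lborel ({a<..<b} \<times> {c<..<d}) f"
    and "f integrable_on ({a<..<b} \<times> {c<..<d})"
    and "integral ({a<..<b} \<times> {c<..<d}) f = integral ({a..b} \<times> {c..d}) g"
proof -
  have *: "cbox (a, c) (b, d) = {a..b} \<times> {c..d}" "box (a, c) (b, d) = {a<..<b} \<times> {c<..<d}"
    by (auto simp: cbox_Pair_eq box_def Basis_prod_def)
  have "set_integrable lborel ({a..b} \<times> {c..d}) g"
    unfolding set_integrable_def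
    by (rule borel_integrable_compact) (auto intro!: compact_Times assms)
  then have "set_integrable lborel ({a<..<b} \<times> {c<..<d}) g"
    by (rule set_integrable_subset) (auto intro!: borel_open open_Times)
  then show i: "set_integrable lborel ({a<..<b} \<times> {c<..<d}) f"
    by (rule set_integrable_cong[THEN iffD1, rotated -1]) (auto simp: assms)
  show "f integrable_on ({a<..<b} \<times> {c<..<d})"
    by (rule set_borel_integral_eq_integral[OF i])
  have "integral ({a<..<b} \<times> {c<..<d}) f = integral ({a<..<b} \<times> {c<..<d}) g"
    by (rule integral_cong) (simp add: assms)
  then show "integral ({a<..<b} \<times> {c<..<d}) f = integral ({a..b} \<times> {c..d}) g"
    using integral_open_interval[of "(a, c)" "(b, d)" g] by (simp add: *)
qed

section \<open>Time derivative of an integral over the rectangle\<close>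

text \<open>
  Time derivatives are only available inside the rectangle, so instead of differentiating under
  the integral the proof integrates \<open>f'\<close> in time and exchanges the integrals.
\<close>

lemma has_real_derivative_integral_time:
  fixes f f' :: "real \<Rightarrow> real \<times> real \<Rightarrow> real"
  assumes cF: "continuous_on ({0<..} \<times> ({a..b} \<times> {c..d})) F"
    and cH: "continuous_on ({0<..} \<times> ({a..b} \<times> {c..d})) H"
    and F: "\<And>t z. t > 0 \<Longrightarrow> z \<in> {a<..<b} \<times> {c<..<d} \<Longrightarrow> F (t, z) = f t z"
    and H: "\<And>t z. t > 0 \<Longrightarrow> z \<in> {a<..<b} \<times> {c<..<d} \<Longrightarrow> H (t, z) = f' t z"
    and der: "\<And>t z. t > 0 \<Longrightarrow> z \<in> {a<..<b} \<times> {c<..<d} \<Longrightarrow>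
      ((\<lambda>s. f s z) has_real_derivative f' t z) (at t)"
    and "t > 0"
  shows "((\<lambda>s. integral ({a<..<b} \<times> {c<..<d}) (f s)) has_real_derivative
    integral ({a<..<b} \<times> {c<..<d}) (f' t)) (at t)"
proof -
  let ?R = "{a<..<b} \<times> {c<..<d}" and ?C = "{a..b} \<times> {c..d}"
  define \<Phi> where "\<Phi> s = integral ?C (\<lambda>z. H (s, z))" for s
  \<comment> \<open>Any base time strictly between 0 and \<open>t\<close> would do. The window
    \<open>{r..2*t}\<close> has \<open>t\<close> in its interior and stays away from time 0, where
    nothing is assumed.\<close>
  define r where "r = t / 2"
  have r: "0 < r" "r < t" using \<open>t > 0\<close> by (simp_all add: r_def)
  have box: "cbox (a, c) (b, d) = ?C" by (simp add: cbox_Pair_eq)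
  have c\<Phi>: "continuous_on {r..2*t} \<Phi>"
    unfolding \<Phi>_def box[symmetric]
    by (rule integral_continuous_on_param, rule continuous_on_subset[OF cH[folded box], THEN continuous_on_eq])
      (use r in auto)
  have cFt: "continuous_on ?C (\<lambda>z. F (s, z))" "continuous_on ?C (\<lambda>z. H (s, z))" if "s > 0" for s
    using that
    by (auto intro!: continuous_intros continuous_on_compose2[OF cF] continuous_on_compose2[OF cH])
  have E: "integral ?R (f s) = integral ?R (f r) + integral {r..s} \<Phi>" if s: "s \<in> {r..2*t}" for s
  proof -
    define K where "K z = integral {r..s} (\<lambda>\<tau>. H (\<tau>, z))" for z
    have cHs: "continuous_on (cbox (r, (a, c)) (s, (b, d))) (\<lambda>(\<tau>, z). H (\<tau>, z))"
      by (rule continuous_on_subset[OF cH[folded box], THEN continuous_on_eq]) (use r in auto)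
    have "continuous_on (?C \<times> cbox r s) (\<lambda>(z, \<tau>). H (\<tau>, z))"
      unfolding case_prod_unfold
      by (rule continuous_on_compose2[OF cH]) (use r in \<open>auto intro!: continuous_intros\<close>)
    then have cK: "continuous_on ?C K"
      using integral_continuous_on_param[of ?C r s "\<lambda>z \<tau>. H (\<tau>, z)"] by (simp add: K_def[abs_def])
    have fK: "f s z = f r z + K z" if z: "z \<in> ?R" for z
    proof -
      have "((\<lambda>\<tau>. H (\<tau>, z)) has_integral (f s z - f r z)) {r..s}"
      proof (rule fundamental_theorem_of_calculus)
        fix \<tau> assume "\<tau> \<in> {r..s}"
        then have "\<tau> > 0" using r by auto
        then show "((\<lambda>s. f s z) has_vector_derivative H (\<tau>, z)) (at \<tau> within {r..s})"
          using der[OF _ z, of \<tau>] H[OF _ z, of \<tau>]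
          by (auto simp: has_real_derivative_iff_has_vector_derivative
              intro: has_vector_derivative_at_within)
      qed (use s in auto)
      then show ?thesis by (simp add: K_def integral_unique)
    qed
    have "integral ?R (f s) = integral ?R (\<lambda>z. f r z + K z)"
      by (rule integral_cong) (rule fK)
    also have "\<dots> = integral ?R (f r) + integral ?R K"
      by (intro integral_add extendable_rect_integral(2)[OF cFt(1)[OF r(1)]] extendable_rect_integral(2)[OF cK])
        (use r F in auto)
    also have "integral ?R K = integral ?C K"
      by (rule extendable_rect_integral(3)[OF cK]) simp
    also have "\<dots> = integral {r..s} \<Phi>"
      using integral_swap_continuous[OF cHs] unfolding \<Phi>_def K_def box by simp
    finally show ?thesis .
  qed
  have "((\<lambda>s. integral {r..s} \<Phi>) has_real_derivative \<Phi> t) (at t within {r..2*t})"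
    by (rule integral_has_real_derivative[OF c\<Phi>]) (use r in auto)
  then have "((\<lambda>s. integral {r..s} \<Phi>) has_real_derivative \<Phi> t) (at t)"
    using r by (simp add: at_within_Icc_at)
  then have "((\<lambda>s. integral ?R (f r) + integral {r..s} \<Phi>) has_real_derivative \<Phi> t) (at t)"
    using DERIV_add[OF DERIV_const] by fastforce
  then have "((\<lambda>s. integral ?R (f s)) has_real_derivative \<Phi> t) (at t)"
    by (rule has_field_derivative_transform_within_open[where S = "{r<..<2*t}"]) (use r in \<open>auto intro!: E[symmetric]\<close>)
  also have "\<Phi> t = integral ?R (f' t)"
    unfolding \<Phi>_def using extendable_rect_integral(3)[OF cFt(2)[OF \<open>t > 0\<close>], of "f' t"] H \<open>t > 0\<close> by simp
  finally show ?thesis .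
qed

lemma DERIV_shift_fst: "((\<lambda>s. f (x + s, y)) has_real_derivative D) (at 0)
    \<longleftrightarrow> ((\<lambda>s. f (s, y)) has_real_derivative D) (at x)"
  using DERIV_shift[of "\<lambda>s. f (s, y)" D 0 x] by (simp add: add.commute)

lemma DERIV_shift_snd: "((\<lambda>s. f (x, y + s)) has_real_derivative D) (at 0)
    \<longleftrightarrow> ((\<lambda>s. f (x, s)) has_real_derivative D) (at y)"
  using DERIV_shift[of "\<lambda>s. f (x, s)" D 0 y] by (simp add: add.commute)

section \<open>The rectangle with its axes, and integration of exact derivatives over it\<close>

locale rectangle =
  fixes a b c d :: real and m i j :: 3
  assumes ab: "a < b" and cd: "c < d" and axes: "UNIV - {m} = {i, j}" and ij: "i \<noteq> j"
begin

abbreviation R :: "(real \<times> real) set" where "R \<equiv> {a<..<b} \<times> {c<..<d}"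
abbreviation Cl :: "(real \<times> real) set" where "Cl \<equiv> {a..b} \<times> {c..d}"

lemma closure_R: "closure R = Cl"
  using ab cd by (simp add: closure_Times)

lemma frontier_R: "frontier R = Cl - R"
  by (simp add: frontier_def closure_R interior_open open_Times)

lemma extendable_integrable:
  fixes f :: "real \<times> real \<Rightarrow> 'b::euclidean_space"
  assumes "extendable R f"
  shows "f integrable_on R" and "set_integrable lborel R f"
  using assms extendable_rect_integral(1,2)[of a b c d _ f] unfolding extendable_def closure_R by blast+

lemma LINT_R:
  fixes f :: "real \<times> real \<Rightarrow> 'b::euclidean_space"
  shows "extendable R f \<Longrightarrow> (LINT x:R|lborel. f x) = integral R f"
  by (rule set_borel_integral_eq_integral(2)) (rule extendable_integrable)

lemma UNIV_axes: "UNIV = {i, j, m}" and m_neq: "m \<noteq> i" "m \<noteq> j"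
  using axes by auto

lemma sum_axes: "(\<Sum>n\<in>UNIV. f n) = f i + f j + f m"
  for f :: "3 \<Rightarrow> real"
  unfolding UNIV_axes using ij m_neq by simp

lemma axis_dir_simps [simp]:
  "axis_dir i j i = (1, 0)" "axis_dir i j j = (0, 1)" "axis_dir i j m = 0"
  using ij m_neq by (simp_all add: axis_dir_def zero_prod_def)

abbreviation has_pd :: "3 \<Rightarrow> (real \<times> real \<Rightarrow> real) \<Rightarrow> real \<Rightarrow> real \<times> real \<Rightarrow> bool" where
  "has_pd l f D z \<equiv> ((\<lambda>s. f (z + s *\<^sub>R axis_dir i j l)) has_real_derivative D) (at 0)"

lemma pd_m [simp]: "pd i j m f z = 0"
  by (simp add: pd_def)

text \<open>The summand of axis \<open>m\<close> is zero; with it the Laplacian has the same index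
  range as the other sums of the model.\<close>

lemma laplacian_eq: "laplacian i j f z = (\<Sum>n\<in>UNIV. pd i j n (pd i j n f) z)"
  by (simp add: laplacian_def sum_axes)

text \<open>The common consequence of both boundary conditions: an extension that takes equal values
  at opposite points of the boundary. It is shared by continuous periodic functions and by products
  with a factor that vanishes on the boundary.\<close>

definition matched_extendable :: "(real \<times> real \<Rightarrow> real) \<Rightarrow> bool" where
  "matched_extendable f \<longleftrightarrow> (\<exists>g. continuous_on Cl g \<and> (\<forall>z\<in>R. g z = f z) \<and>
     (\<forall>y\<in>{c..d}. g (a, y) = g (b, y)) \<and> (\<forall>x\<in>{a..b}. g (x, c) = g (x, d)))"

text \<open>The fundamental theorem of calculus on each slice along axis \<open>n\<close> leaves the
  difference of the extension at opposite sides, which is zero; Fubini then gives the integral over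
  the rectangle.\<close>

lemma integral_pd_eq_0:
  assumes "matched_extendable f" and "extendable R f'" and der: "\<And>z. z \<in> R \<Longrightarrow> has_pd n f (f' z) z"
  shows "integral R f' = 0"
proof -
  obtain g where cg: "continuous_on Cl g" and g: "\<And>z. z \<in> R \<Longrightarrow> g z = f z"
    and gx: "\<And>y. y \<in> {c..d} \<Longrightarrow> g (a, y) = g (b, y)" and gy: "\<And>x. x \<in> {a..b} \<Longrightarrow> g (x, c) = g (x, d)"
    using assms(1) unfolding matched_extendable_def by blast
  obtain h where ch: "continuous_on Cl h" and h: "\<And>z. z \<in> R \<Longrightarrow> h z = f' z"
    using assms(2) unfolding extendable_def closure_R by blast
  have I: "integral R f' = integral Cl h" using extendable_rect_integral(3)[OF ch h] .
  consider "n = i" | "n = j" | "n = m" using UNIV_axes by blast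
  then show ?thesis
  proof cases
    case 1
    have "integral {a..b} (\<lambda>x. h (x, y)) = 0" if y: "y \<in> {c<..<d}" for y
    proof -
      have "((\<lambda>x. h (x, y)) has_integral (g (b, y) - g (a, y))) {a..b}"
      proof (rule fundamental_theorem_of_calculus_interior)
        fix x assume x: "x \<in> {a<..<b}"
        then have "((\<lambda>s. f (s, y)) has_real_derivative h (x, y)) (at x)"
          using der[of "(x, y)"] y by (simp add: 1 DERIV_shift_fst h)
        then have "((\<lambda>s. g (s, y)) has_real_derivative h (x, y)) (at x)"
          by (rule has_field_derivative_transform_within_open[where S = "{a<..<b}"]) (use x y g in auto)
        then show "((\<lambda>s. g (s, y)) has_vector_derivative h (x, y)) (at x)"
          by (simp add: has_real_derivative_iff_has_vector_derivative)
      qed (use ab y in \<open>auto intro: continuous_on_slice(1)[OF cg]\<close>)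
      then show ?thesis using gx[of y] y by (simp add: integral_unique)
    qed
    then show ?thesis unfolding I integral_rect(2)[OF ch] by (rule integral_eq_0_interior)
  next
    case 2
    have "integral {c..d} (\<lambda>y. h (x, y)) = 0" if x: "x \<in> {a<..<b}" for x
    proof -
      have "((\<lambda>y. h (x, y)) has_integral (g (x, d) - g (x, c))) {c..d}"
      proof (rule fundamental_theorem_of_calculus_interior)
        fix y assume y: "y \<in> {c<..<d}"
        then have "((\<lambda>s. f (x, s)) has_real_derivative h (x, y)) (at y)"
          using der[of "(x, y)"] x by (simp add: 2 DERIV_shift_snd h)
        then have "((\<lambda>s. g (x, s)) has_real_derivative h (x, y)) (at y)"
          by (rule has_field_derivative_transform_within_open[where S = "{c<..<d}"]) (use x y g in auto)
        then show "((\<lambda>s. g (x, s)) has_vector_derivative h (x, y)) (at y)"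
          by (simp add: has_real_derivative_iff_has_vector_derivative)
      qed (use cd x in \<open>auto intro: continuous_on_slice(2)[OF cg]\<close>)
      then show ?thesis using gy[of x] x by (simp add: integral_unique)
    qed
    then show ?thesis unfolding I integral_rect(1)[OF ch] by (rule integral_eq_0_interior)
  next
    case 3
    \<comment> \<open>The projected direction of axis \<open>m\<close> is the zero vector, so
      \<open>has_pd\<close> speaks of a constant function, whose only derivative is 0.\<close>
    have "f' z = 0" if "z \<in> R" for z
      using DERIV_unique[OF der[OF that]] by (simp add: 3)
    then have "integral R f' = integral R (\<lambda>_. 0)" by (intro integral_cong) auto
    then show ?thesis by simp
  qed
qed

text \<open>The diameter is the diagonal. The strictness is what keeps the cosine of
  \<open>wirtinger_dirichlet\<close> positive at the end points.\<close>

lemma diameter_R: "b - a < diameter R" "d - c < diameter R"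
proof -
  have "diameter R = diameter (cbox (a, c) (b, d))"
    using diameter_closure[of R] by (simp add: closure_R cbox_Pair_eq bounded_Times)
  also have "\<dots> = sqrt ((b - a)^2 + (d - c)^2)"
    using ab cd by (subst diameter_cbox) (auto simp: Basis_prod_def dist_Pair_Pair dist_real_def power2_commute)
  finally have *: "diameter R = sqrt ((b - a)^2 + (d - c)^2)" .
  show "b - a < diameter R" "d - c < diameter R"
    unfolding * using ab cd by (auto intro!: real_less_rsqrt)
qed

lemma poincare_const_eq: "poincare_const R = (pi / diameter R)^2"
  by (simp add: poincare_const_def power_divide)

lemma poincare_const_pos: "poincare_const R > 0"
  using diameter_R(1) ab by (simp add: poincare_const_eq)

text \<open>The inequality along axis \<open>i\<close> alone gives the bound, since the squares for
  the other axes only enlarge the right side.\<close>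

lemma poincare_no_slip:
  assumes cf: "continuous_on Cl f" and cpd: "\<And>n. extendable R (pd i j n f)"
    and der: "\<And>n z. z \<in> R \<Longrightarrow> has_pd n f (pd i j n f z) z"
    and bc: "\<And>z. z \<in> frontier R \<Longrightarrow> f z = 0"
  shows "poincare_const R * integral R (\<lambda>z. (f z)^2) \<le> (\<Sum>n\<in>UNIV. integral R (\<lambda>z. (pd i j n f z)^2))"
proof -
  obtain h where ch: "continuous_on Cl h" and h: "\<And>z. z \<in> R \<Longrightarrow> h z = pd i j i f z"
    using cpd[of i] unfolding extendable_def closure_R by blast
  then have "f (a, y) = 0" "f (b, y) = 0" if "y \<in> {c..d}" for y
    using that bc[of "(a, y)"] bc[of "(b, y)"] ab by (auto simp: frontier_R)
  then have "(pi / diameter R)^2 * integral Cl (\<lambda>z. (f z)^2) \<le> integral Cl (\<lambda>z. (h z)^2)"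
    using der[where n = i] by (intro poincare_rect_dirichlet ab diameter_R cf ch) (auto simp: DERIV_shift_fst h)
  also have "integral Cl (\<lambda>z. (h z)^2) = integral R (\<lambda>z. (pd i j i f z)^2)"
    by (rule extendable_rect_integral(3)[symmetric]) (auto intro!: continuous_intros ch simp: h)
  also have "integral Cl (\<lambda>z. (f z)^2) = integral R (\<lambda>z. (f z)^2)"
    by (rule extendable_rect_integral(3)[symmetric]) (auto intro!: continuous_intros cf)
  also have "integral R (\<lambda>z. (pd i j i f z)^2) \<le> (\<Sum>n\<in>UNIV. integral R (\<lambda>z. (pd i j n f z)^2))"
    by (rule member_le_sum) (auto intro!: integral_nonneg extendable_integrable extendable_power2 cpd)
  finally show ?thesis by (simp add: poincare_const_eq)
qed

text \<open>Smoothness on the whole plane supplies the derivatives on the closed cell that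
  \<open>poincare_rect_periodic\<close> asks for, and periodicity matches its opposite
  sides.\<close>

lemma poincare_periodic:
  assumes cf: "continuous_on UNIV f" and cpd: "\<And>n. continuous_on UNIV (pd i j n f)"
    and der: "\<And>n z. has_pd n f (pd i j n f z) z"
    and per: "\<And>z. f (z + (b - a, 0)) = f z" "\<And>z. f (z + (0, d - c)) = f z"
    and mean: "integral R f = 0"
  shows "poincare_const R * integral R (\<lambda>z. (f z)^2) \<le> (\<Sum>n\<in>UNIV. integral R (\<lambda>z. (pd i j n f z)^2))"
proof -
  note c = continuous_on_subset[OF cf, of Cl, simplified] continuous_on_subset[OF cpd, of Cl, simplified]
  have eq: "integral R (\<lambda>z. (g z)^2) = integral Cl (\<lambda>z. (g z)^2)" if "continuous_on Cl g"
    for g :: "real \<times> real \<Rightarrow> real"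
    by (rule extendable_rect_integral(3)) (auto intro!: continuous_intros that)
  have "integral Cl f = 0"
    using mean extendable_rect_integral(3)[OF c(1), of f] by simp
  moreover have "f (a, y) = f (b, y)" "f (x, c) = f (x, d)" for x y
    using per(1)[of "(a, y)"] per(2)[of "(x, c)"] by simp_all
  ultimately have "(pi / diameter R)^2 * integral Cl (\<lambda>z. (f z)^2)
      \<le> integral Cl (\<lambda>z. (pd i j i f z)^2) + integral Cl (\<lambda>z. (pd i j j f z)^2)"
    using der[where n = i] der[where n = j]
    by (intro poincare_rect_periodic ab cd diameter_R c) (auto simp: DERIV_shift_fst DERIV_shift_snd)
  then show ?thesis by (simp add: poincare_const_eq sum_axes eq c)
qed

end

section \<open>Consequences of the smoothness hypotheses at a fixed time\<close>

lemma extends_to_closure_slice: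
  assumes "extends_to_closure S f" "t > 0"
  shows "extendable S (f t)"
proof -
  obtain g where g: "continuous_on ({0<..} \<times> closure S) g" "\<forall>t>0. \<forall>x\<in>S. g (t, x) = f t x"
    using assms(1) unfolding extends_to_closure_def by blast
  have "continuous_on (closure S) (\<lambda>x. g (t, x))"
    by (rule continuous_on_compose2[OF g(1)]) (use assms in \<open>auto intro!: continuous_intros\<close>)
  then show ?thesis unfolding extendable_def using g(2) assms(2) by blast
qed

lemma extends_to_closure_subset:
  assumes "extends_to_closure T f" "S \<subseteq> T"
  shows "extends_to_closure S f"
proof -
  have "{0::real<..} \<times> closure S \<subseteq> {0<..} \<times> closure T"
    using closure_mono[OF assms(2)] by blast
  then show ?thesis
    using assms unfolding extends_to_closure_def by (meson continuous_on_subset subsetD)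
qed

lemma Ck_closure_subset:
  assumes "S \<subseteq> T"
  shows "Ck_closure n i j T f \<Longrightarrow> Ck_closure n i j S f"
proof (induction n arbitrary: f)
  case 0
  then show ?case using extends_to_closure_subset[OF _ assms] by simp
next
  case (Suc n)
  then show ?case using extends_to_closure_subset[OF _ assms, of f] assms by auto
qed

lemma Ck_closure_extends: "Ck_closure n i j S f \<Longrightarrow> extends_to_closure S f"
  by (cases n) auto

lemma Ck_closure_slice:
  assumes "Ck_closure (Suc n) i j S f" "t > 0"
  shows "extendable S (f t)" and "extendable S (pd i j l (f t))"
    and "x \<in> S \<Longrightarrow> ((\<lambda>s. f t (x + s *\<^sub>R axis_dir i j l)) has_real_derivative pd i j l (f t) x) (at 0)"
    and "Ck_closure n i j S (\<lambda>t. pd i j l (f t))"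
proof -
  show "extendable S (f t)"
    using Ck_closure_extends[OF assms(1)] assms(2) by (rule extends_to_closure_slice)
  show *: "Ck_closure n i j S (\<lambda>t. pd i j l (f t))" using assms(1) by simp
  show "extendable S (pd i j l (f t))"
    using Ck_closure_extends[OF *] assms(2) by (rule extends_to_closure_slice)
  show "((\<lambda>s. f t (x + s *\<^sub>R axis_dir i j l)) has_real_derivative pd i j l (f t) x) (at 0)" if "x \<in> S"
    unfolding pd_def using assms that by (auto simp: DERIV_deriv_iff_field_differentiable)
qed

text \<open>Periodic fields are smooth on the whole plane; restricted to the cell, they share all
  interior facts with the no-slip case.\<close>

lemma smooth_perturbation_subset:
  "S \<subseteq> T \<Longrightarrow> smooth_perturbation i j T u p \<Longrightarrow> smooth_perturbation i j S u p"
  unfolding smooth_perturbation_def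
  using Ck_closure_subset[of S T] extends_to_closure_subset[of T _ S] by blast

lemma extendable_UNIV: "extendable UNIV f \<longleftrightarrow> continuous_on UNIV f"
proof
  assume "extendable UNIV f"
  then obtain g where "continuous_on UNIV g" "\<forall>x. g x = f x" unfolding extendable_def by auto
  moreover from this have "g = f" by auto
  ultimately show "continuous_on UNIV f" by simp
qed (simp add: extendable_continuous)

lemma pd_periodic: "(\<And>z. f (z + h) = f z) \<Longrightarrow> pd i j l f (z + h) = pd i j l f z"
  unfolding pd_def by (rule arg_cong[where f = "\<lambda>g. deriv g 0"]) (metis add.commute add.left_commute)

section \<open>Boundary matching, the energy estimate and the time derivative of the energy\<close>

context rectangle begin

text \<open>The factor \<open>f\<close> makes the product vanish on the frontier whatever the
  extension of \<open>g\<close> is. This serves derivatives and the pressure, which carry no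
  boundary condition of their own.\<close>

lemma matched_extendable_frontier:
  assumes cf: "continuous_on Cl f" and f0: "\<And>z. z \<in> frontier R \<Longrightarrow> f z = 0" and "extendable R g"
  shows "matched_extendable (\<lambda>z. f z * g z)"
proof -
  obtain h where h: "continuous_on Cl h" "\<And>z. z \<in> R \<Longrightarrow> h z = g z"
    using \<open>extendable R g\<close> unfolding extendable_def closure_R by blast
  then have "f (a, y) = 0" "f (b, y) = 0" if "y \<in> {c..d}" for y
    using that f0[of "(a, y)"] f0[of "(b, y)"] ab by (auto simp: frontier_R)
  moreover have "f (x, c) = 0" "f (x, d) = 0" if "x \<in> {a..b}" for x
    using that f0[of "(x, c)"] f0[of "(x, d)"] cd by (auto simp: frontier_R)
  ultimately show ?thesis
    unfolding matched_extendable_def by (intro exI[of _ "\<lambda>z. f z * h z"]) (auto intro!: continuous_intros cf h)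
qed

lemma matched_extendable_periodic:
  assumes "continuous_on UNIV f" "\<And>z. f (z + (b - a, 0)) = f z" "\<And>z. f (z + (0, d - c)) = f z"
  shows "matched_extendable f"
proof -
  have "f (a, y) = f (b, y)" "f (x, c) = f (x, d)" for x y
    using assms(2)[of "(a, y)"] assms(3)[of "(x, c)"] by simp_all
  then show ?thesis
    unfolding matched_extendable_def using continuous_on_subset[OF assms(1), of Cl] by blast
qed

text \<open>The whole estimate at one fixed time: \<open>v\<close> is the velocity, \<open>w\<close>
  its time derivative, \<open>q\<close> the pressure and \<open>g\<close> the force. The boundary
  condition enters only through \<open>m1\<close>, \<open>m2\<close>, \<open>m3\<close> and
  \<open>poincare\<close>, so one proof serves both cases.\<close>

lemma energy_estimate:
  fixes v w U g :: "3 \<Rightarrow> real \<times> real \<Rightarrow> real" and k :: "real^3" and F :: "real^3^3"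
  assumes cv: "\<And>l. extendable R (v l)" and cpd: "\<And>l n. extendable R (pd i j n (v l))"
    and cpd2: "\<And>l n. extendable R (pd i j n (pd i j n (v l)))"
    and dv: "\<And>l n z. z \<in> R \<Longrightarrow> has_pd n (v l) (pd i j n (v l) z) z"
    and dv2: "\<And>l n z. z \<in> R \<Longrightarrow> has_pd n (pd i j n (v l)) (pd i j n (pd i j n (v l)) z) z"
    and cq: "extendable R q" and cpq: "\<And>n. extendable R (pd i j n q)"
    and dq: "\<And>n z. z \<in> R \<Longrightarrow> has_pd n q (pd i j n q z) z"
    and cU: "\<And>l. extendable R (U l)" and cpU: "\<And>l n. extendable R (pd i j n (U l))" and cg: "\<And>l. extendable R (g l)"
    and model: "\<And>l z. z \<in> R \<Longrightarrow> w l z = 1 / Rey * laplacian i j (v l) z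
               - (\<Sum>n\<in>UNIV. v n z * pd i j n (v l) z)
               - (\<Sum>n\<in>UNIV. U n z * pd i j n (v l) z)
               - (\<Sum>n\<in>UNIV. v n z * pd i j n (U l) z)
               - pd i j l q z + (\<Sum>n\<in>UNIV. F $ l $ n * v n z) + g l z"
    and div: "\<And>z. z \<in> R \<Longrightarrow> (\<Sum>n\<in>UNIV. pd i j n (v n) z) = 0"
    and m1: "\<And>l n. matched_extendable (\<lambda>z. v l z * pd i j n (v l) z)"
    and m2: "\<And>l. matched_extendable (\<lambda>z. v l z * q z)"
    and m3: "\<And>l n. matched_extendable (\<lambda>z. v n z * (v l z)^2)"
    and poincare: "\<And>l. C * integral R (\<lambda>z. (v l z)^2) \<le> (\<Sum>n\<in>UNIV. integral R (\<lambda>z. (pd i j n (v l) z)^2))"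
    and Rey: "Rey > 0" and k: "\<And>l. k $ l > 0" and kij: "k $ i = k $ j"
  shows "(\<Sum>l\<in>UNIV. k $ l * integral R (\<lambda>z. v l z * w l z)) \<le>
    - (\<Sum>l\<in>UNIV. k $ l * integral R (\<lambda>z. C / Rey * (v l z)^2
         + (\<Sum>n\<in>UNIV. U n z * v l z * pd i j n (v l) z)
         + (\<Sum>n\<in>UNIV. v n z * v l z * pd i j n (U l) z)
         - (\<Sum>n\<in>UNIV. v l z * F $ l $ n * v n z)
         - v l z * g l z))"
proof -
  \<comment> \<open>\<open>S\<close> collects the terms that reach the bound unchanged.\<close>
  define S where "S l z = (\<Sum>n\<in>UNIV. U n z * v l z * pd i j n (v l) z)
         + (\<Sum>n\<in>UNIV. v n z * v l z * pd i j n (U l) z)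
         - (\<Sum>n\<in>UNIV. v l z * F $ l $ n * v n z)
         - v l z * g l z" for l z
  \<comment> \<open>\<open>A\<close>, \<open>B\<close> and \<open>E\<close> are the derivatives
    along axis \<open>n\<close> of \<open>v l * pd i j n (v l)\<close>, \<open>v n * (v l)^2\<close>
    and \<open>v n * q\<close>, written out by the product rule. Each integrates to zero by
    \<open>integral_pd_eq_0\<close>.\<close>
  define A where "A l n z = v l z * pd i j n (pd i j n (v l)) z + (pd i j n (v l) z)^2" for l n z
  define B where "B l n z = pd i j n (v n) z * (v l z)^2 + v n z * (2 * v l z * pd i j n (v l) z)" for l n z
  define E where "E n z = pd i j n (v n) z * q z + v n z * pd i j n q z" for n z
  define G where "G l = (\<Sum>n\<in>UNIV. integral R (\<lambda>z. (pd i j n (v l) z)^2))" for l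
  define J where "J l = integral R (\<lambda>z. v l z * pd i j l q z)" for l
  note ci = extendable_intros cv cpd cpd2 cq cpq cU cpU cg
  have cS: "extendable R (S l)" for l unfolding S_def by (intro ci)
  have cA: "extendable R (A l n)" for l n unfolding A_def by (intro ci)
  have cB: "extendable R (B l n)" for l n unfolding B_def by (intro ci)
  have cE: "extendable R (E n)" for n unfolding E_def by (intro ci)
  have A: "(A l n has_integral 0) R" for l n
  proof -
    have "integral R (A l n) = 0"
      by (rule integral_pd_eq_0[OF m1[of l n] cA, of n])
        (auto simp: A_def power2_eq_square intro!: derivative_eq_intros dv dv2)
    then show ?thesis using extendable_integrable(1)[OF cA, of l n] by (simp add: has_integral_iff)
  qed
  have B: "(B l n has_integral 0) R" for l n
  proof -
    have "integral R (B l n) = 0"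
      by (rule integral_pd_eq_0[OF m3[of n l] cB, of n])
        (auto simp: B_def intro!: derivative_eq_intros dv)
    then show ?thesis using extendable_integrable(1)[OF cB, of l n] by (simp add: has_integral_iff)
  qed
  have E: "(E n has_integral 0) R" for n
  proof -
    have "integral R (E n) = 0"
      by (rule integral_pd_eq_0[OF m2[of n] cE, of n])
        (auto simp: E_def intro!: derivative_eq_intros dv dq)
    then show ?thesis using extendable_integrable(1)[OF cE, of n] by (simp add: has_integral_iff)
  qed
  have int: "(f has_integral integral R f) R" if "extendable R f" for f :: "real \<times> real \<Rightarrow> real"
    using extendable_integrable(1)[OF that] by (rule integrable_integral)
  have balance: "integral R (\<lambda>z. v l z * w l z) = - (1 / Rey * G l) - J l - integral R (S l)" for l
  proof -
    have "v l z * w l z = 1 / Rey * (\<Sum>n\<in>UNIV. A l n z - (pd i j n (v l) z)^2)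
        - 1/2 * (\<Sum>n\<in>UNIV. B l n z) - v l z * pd i j l q z - S l z" if z: "z \<in> R" for z
    proof -
      \<comment> \<open>The first summand is zero by \<open>div\<close>, so the sum of
        \<open>B\<close> is twice the convection term; hence the factor \<open>1/2\<close>
        above.\<close>
      have "(\<Sum>n\<in>UNIV. B l n z) = (\<Sum>n\<in>UNIV. pd i j n (v n) z) * (v l z)^2
          + 2 * v l z * (\<Sum>n\<in>UNIV. v n z * pd i j n (v l) z)"
        unfolding B_def sum.distrib sum_distrib_left sum_distrib_right by (simp add: mult_ac)
      moreover have "(\<Sum>n\<in>UNIV. A l n z - (pd i j n (v l) z)^2) = v l z * laplacian i j (v l) z"
        by (simp add: A_def laplacian_eq sum_distrib_left)
      moreover have "S l z = v l z * ((\<Sum>n\<in>UNIV. U n z * pd i j n (v l) z)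
          + (\<Sum>n\<in>UNIV. v n z * pd i j n (U l) z) - (\<Sum>n\<in>UNIV. F $ l $ n * v n z) - g l z)"
        by (simp add: S_def right_diff_distrib distrib_left sum_distrib_left mult_ac)
      ultimately show ?thesis
        unfolding model[OF z] div[OF z] by (simp add: algebra_simps)
    qed
    then have "integral R (\<lambda>z. v l z * w l z) = integral R (\<lambda>z. 1 / Rey * (\<Sum>n\<in>UNIV. A l n z - (pd i j n (v l) z)^2)
        - 1/2 * (\<Sum>n\<in>UNIV. B l n z) - v l z * pd i j l q z - S l z)"
      by (rule integral_cong)
    also have "\<dots> = 1 / Rey * (\<Sum>n\<in>UNIV. 0 - integral R (\<lambda>z. (pd i j n (v l) z)^2))
        - 1/2 * (\<Sum>n\<in>(UNIV::3 set). 0) - J l - integral R (S l)"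
      unfolding J_def
      by (intro integral_unique has_integral_diff has_integral_mult_right has_integral_sum A B int ci cS)
        simp_all
    also have "\<dots> = - (1 / Rey * G l) - J l - integral R (S l)"
      by (simp add: G_def sum_negf)
    finally show ?thesis .
  qed
  \<comment> \<open>By \<open>div\<close>, the sum of \<open>v l * pd i j l q\<close> equals the
    divergence of \<open>q v\<close>, whose integral vanishes.\<close>
  have "(\<Sum>l\<in>UNIV. J l) = 0"
  proof -
    have "((\<lambda>z. \<Sum>l\<in>UNIV. v l z * pd i j l q z) has_integral (\<Sum>l\<in>UNIV. J l)) R"
      unfolding J_def by (intro has_integral_sum int ci) simp_all
    moreover have "((\<lambda>z. \<Sum>l\<in>UNIV. v l z * pd i j l q z) has_integral (\<Sum>l\<in>(UNIV::3 set). 0)) R"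
    proof (rule has_integral_eq)
      show "((\<lambda>z. \<Sum>l\<in>UNIV. E l z) has_integral (\<Sum>l\<in>(UNIV::3 set). 0)) R"
        by (intro has_integral_sum E) simp_all
      show "(\<Sum>l\<in>UNIV. E l z) = (\<Sum>l\<in>UNIV. v l z * pd i j l q z)" if "z \<in> R" for z
        using div[OF that] by (simp add: E_def sum.distrib flip: sum_distrib_right)
    qed
    ultimately have "(\<Sum>l\<in>UNIV. J l) = (\<Sum>l\<in>(UNIV::3 set). 0)"
      by (rule has_integral_unique)
    then show ?thesis by simp
  qed
  moreover have "J m = 0" by (simp add: J_def)
  \<comment> \<open>The pressure term only sees the axes \<open>i\<close> and \<open>j\<close>, whose weights agree.\<close>
  ultimately have J: "(\<Sum>l\<in>UNIV. k $ l * J l) = 0"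
    by (simp add: sum_axes kij flip: distrib_left)
  have target: "integral R (\<lambda>z. C / Rey * (v l z)^2
         + (\<Sum>n\<in>UNIV. U n z * v l z * pd i j n (v l) z)
         + (\<Sum>n\<in>UNIV. v n z * v l z * pd i j n (U l) z)
         - (\<Sum>n\<in>UNIV. v l z * F $ l $ n * v n z)
         - v l z * g l z) = C / Rey * integral R (\<lambda>z. (v l z)^2) + integral R (S l)" for l
  proof -
    have "integral R (\<lambda>z. C / Rey * (v l z)^2 + S l z) = C / Rey * integral R (\<lambda>z. (v l z)^2) + integral R (S l)"
      by (intro integral_unique has_integral_add has_integral_mult_right int ci cS)
    then show ?thesis by (simp add: S_def algebra_simps)
  qed
  have "k $ l * (C / Rey * integral R (\<lambda>z. (v l z)^2)) \<le> k $ l * (1 / Rey * G l)" for l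
    using poincare[of l] Rey k[of l] by (intro mult_left_mono) (auto simp: G_def divide_right_mono)
  then have "(\<Sum>l\<in>UNIV. k $ l * (C / Rey * integral R (\<lambda>z. (v l z)^2))) \<le> (\<Sum>l\<in>UNIV. k $ l * (1 / Rey * G l))"
    by (rule sum_mono)
  then show ?thesis
    unfolding balance target using J
    by (simp add: distrib_left right_diff_distrib sum.distrib sum_subtractf sum_negf)
qed

lemma has_real_derivative_energy:
  fixes u :: "real \<Rightarrow> real \<times> real \<Rightarrow> real^3"
  assumes u: "\<And>l. extends_to_closure R (\<lambda>t x. u t x $ l)"
    and w: "\<And>l. extends_to_closure R (\<lambda>t x. deriv (\<lambda>s. u s x $ l) t)"
    and diff: "\<And>l t x. t > 0 \<Longrightarrow> x \<in> R \<Longrightarrow> (\<lambda>s. u s x $ l) field_differentiable at t"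
    and t: "t > 0"
  shows "((\<lambda>s. energy k R (u s)) has_real_derivative
    (\<Sum>l\<in>UNIV. k $ l * integral R (\<lambda>z. u t z $ l * deriv (\<lambda>s. u s z $ l) t))) (at t)"
proof -
  have "((\<lambda>s. integral R (\<lambda>z. (u s z $ l)^2)) has_real_derivative
      integral R (\<lambda>z. 2 * (u t z $ l * deriv (\<lambda>s. u s z $ l) t))) (at t)" for l
  proof -
    obtain g where g: "continuous_on ({0<..} \<times> Cl) g" "\<And>t x. t > 0 \<Longrightarrow> x \<in> R \<Longrightarrow> g (t, x) = u t x $ l"
      using u[of l] unfolding extends_to_closure_def closure_R by blast
    obtain h where h: "continuous_on ({0<..} \<times> Cl) h"
      "\<And>t x. t > 0 \<Longrightarrow> x \<in> R \<Longrightarrow> h (t, x) = deriv (\<lambda>s. u s x $ l) t"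
      using w[of l] unfolding extends_to_closure_def closure_R by blast
    have d: "((\<lambda>s. u s x $ l) has_real_derivative deriv (\<lambda>s. u s x $ l) t) (at t)"
      if "t > 0" "x \<in> R" for t x
      using diff[OF that] by (simp add: DERIV_deriv_iff_field_differentiable)
    show ?thesis
      by (rule has_real_derivative_integral_time[where F = "\<lambda>z. (g z)^2" and H = "\<lambda>z. 2 * (g z * h z)"])
        (use t in \<open>auto intro!: continuous_intros g h derivative_eq_intros d simp: g h\<close>)
  qed
  then have "((\<lambda>s. 1/2 * (\<Sum>l\<in>UNIV. k $ l * integral R (\<lambda>z. (u s z $ l)^2))) has_real_derivative
      1/2 * (\<Sum>l\<in>UNIV. k $ l * integral R (\<lambda>z. 2 * (u t z $ l * deriv (\<lambda>s. u s z $ l) t)))) (at t)"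
    by (intro DERIV_cmult DERIV_sum)
  moreover have "1/2 * (\<Sum>l\<in>UNIV. k $ l * integral R (\<lambda>z. 2 * (u t z $ l * deriv (\<lambda>s. u s z $ l) t)))
      = (\<Sum>l\<in>UNIV. k $ l * integral R (\<lambda>z. u t z $ l * deriv (\<lambda>s. u s z $ l) t))"
    by (simp add: sum_distrib_left)
  \<comment> \<open>Integrability of the squares is known at positive times only, so the identity,
    and with it the transfer of the derivative, is stated on the open half line.\<close>
  moreover have "1/2 * (\<Sum>l\<in>UNIV. k $ l * integral R (\<lambda>z. (u s z $ l)^2)) = energy k R (u s)" if "s > 0" for s
  proof -
    have c: "extendable R (\<lambda>z. (u s z $ l)^2)" for l
      by (intro extendable_power2 extends_to_closure_slice[OF u that])
    have "energy k R (u s) = 1/2 * integral R (\<lambda>z. \<Sum>l\<in>UNIV. k $ l * (u s z $ l)^2)"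
      unfolding energy_def by (subst LINT_R) (auto intro!: extendable_sum extendable_mult extendable_const c)
    then show ?thesis
      by (simp add: integral_sum integrable_on_mult_right extendable_integrable c)
  qed
  ultimately show ?thesis
    by (auto intro: has_field_derivative_transform_within_open[where S = "{0<..}"] t)
qed

end

text \<open>The existence of the derivative is part of the conclusion, through \<open>V'\<close>;
  \<open>deriv\<close> alone would denote some number even where the energy is not differentiable.
  In the periodic alternative smoothness is required on the whole plane, so that derivatives also
  match across opposite sides of the cell.\<close>

theorem proposition1:
  fixes m i j :: 3
    and a\<^sub>i b\<^sub>i a\<^sub>j b\<^sub>j Rey :: real
    and \<Omega> :: "(real \<times> real) set"
    and F :: "real^3^3"
    and k :: "real^3"
    and U :: "real \<times> real \<Rightarrow> real^3" and P :: "real \<times> real \<Rightarrow> real"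
    and d u :: "real \<Rightarrow> real \<times> real \<Rightarrow> real^3" and p :: "real \<Rightarrow> real \<times> real \<Rightarrow> real"
  assumes "UNIV - {m} = {i, j}" and "i \<noteq> j"
    and "a\<^sub>i < b\<^sub>i" and "a\<^sub>j < b\<^sub>j" and "\<Omega> = {a\<^sub>i<..<b\<^sub>i} \<times> {a\<^sub>j<..<b\<^sub>j}"
    and "Rey > 0"
    and "smooth_base_flow i j \<Omega> U P" and "stationary_flow Rey F i j \<Omega> U P"
    and "\<forall>l. Ck_closure 0 i j \<Omega> (\<lambda>t x. d t x $ l)"
    and "perturbation_model Rey F U d i j \<Omega> u p"
    and "smooth_perturbation i j \<Omega> u p \<and> no_slip \<Omega> u \<or>
         smooth_perturbation i j UNIV u p \<and> periodic_zero_mean (b\<^sub>i - a\<^sub>i) (b\<^sub>j - a\<^sub>j) \<Omega> u p"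
    and "\<forall>l. k $ l > 0" and "k $ i = k $ j"
  shows "poincare_const \<Omega> > 0 \<and>
    (\<forall>t>0. \<exists>V'. ((\<lambda>s. energy k \<Omega> (u s)) has_real_derivative V') (at t) \<and>
       V' \<le> - (\<Sum>l\<in>UNIV. k $ l *
         (LINT x:\<Omega>|lborel.
            poincare_const \<Omega> / Rey * (u t x $ l)^2
            + (\<Sum>n\<in>UNIV. U x $ n * u t x $ l * pd i j n (\<lambda>y. u t y $ l) x)
            + (\<Sum>n\<in>UNIV. u t x $ n * u t x $ l * pd i j n (\<lambda>y. U y $ l) x)
            - (\<Sum>n\<in>UNIV. u t x $ l * F $ l $ n * u t x $ n)
            - u t x $ l * d t x $ l)))"
proof -
  interpret rectangle a\<^sub>i b\<^sub>i a\<^sub>j b\<^sub>j m i j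
    using assms(1-4) by unfold_locales
  have \<Omega>: "\<Omega> = R" by (rule assms(5))
  have smooth: "smooth_perturbation i j R u p"
    using assms(11) smooth_perturbation_subset[OF subset_UNIV] unfolding \<Omega> by blast
  have "\<exists>V'. ((\<lambda>s. energy k R (u s)) has_real_derivative V') (at t) \<and>
       V' \<le> - (\<Sum>l\<in>UNIV. k $ l *
         (LINT x:R|lborel.
            poincare_const R / Rey * (u t x $ l)^2
            + (\<Sum>n\<in>UNIV. U x $ n * u t x $ l * pd i j n (\<lambda>y. u t y $ l) x)
            + (\<Sum>n\<in>UNIV. u t x $ n * u t x $ l * pd i j n (\<lambda>y. U y $ l) x)
            - (\<Sum>n\<in>UNIV. u t x $ l * F $ l $ n * u t x $ n)
            - u t x $ l * d t x $ l))" if t: "t > 0" for t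
  proof (intro exI conjI)
    let ?w = "\<lambda>l x. deriv (\<lambda>s. u s x $ l) t"
    have Ck_u: "Ck_closure (Suc 1) i j R (\<lambda>t x. u t x $ l)" for l
      using smooth by (simp add: smooth_perturbation_def numeral_2_eq_2)
    have Ck_p: "Ck_closure (Suc 0) i j R p"
      using smooth by (simp add: smooth_perturbation_def)
    have Ck_U: "Ck_closure (Suc 1) i j R (\<lambda>t x. U x $ l)" for l
      using assms(7) by (simp add: smooth_base_flow_def numeral_2_eq_2 \<Omega>)
    note u = Ck_closure_slice[OF Ck_u t]
    \<comment> \<open>\<open>u(4)\<close> is the smoothness of the first derivatives; the same lemma
      applied to it gives the second derivatives.\<close>
    note pdu = Ck_closure_slice[OF u(4)[unfolded One_nat_def] t]
    note p = Ck_closure_slice[OF Ck_p t]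
    note U = Ck_closure_slice[OF Ck_U t]
    have d: "extendable R (\<lambda>x. d t x $ l)" for l
      using assms(9) t by (intro extends_to_closure_slice) (auto simp: \<Omega>)
    \<comment> \<open>Proving the derivative first determines the witness \<open>V'\<close> for the
      inequality.\<close>
    show "((\<lambda>s. energy k R (u s)) has_real_derivative
        (\<Sum>l\<in>UNIV. k $ l * integral R (\<lambda>x. u t x $ l * ?w l x))) (at t)"
      using smooth Ck_closure_extends[OF Ck_u] t
      by (intro has_real_derivative_energy) (auto simp: smooth_perturbation_def)
    \<comment> \<open>Everything that depends on the boundary condition is gathered here, in the
      form \<open>energy_estimate\<close> expects.\<close>
    have bc: "(\<forall>l n. matched_extendable (\<lambda>x. u t x $ l * pd i j n (\<lambda>y. u t y $ l) x)) \<and>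
        (\<forall>l. matched_extendable (\<lambda>x. u t x $ l * p t x)) \<and>
        (\<forall>l n. matched_extendable (\<lambda>x. u t x $ n * (u t x $ l)^2)) \<and>
        (\<forall>l. poincare_const R * integral R (\<lambda>x. (u t x $ l)^2)
          \<le> (\<Sum>n\<in>UNIV. integral R (\<lambda>x. (pd i j n (\<lambda>y. u t y $ l) x)^2)))"
      using assms(11) unfolding \<Omega>
    proof (elim disjE conjE)
      assume "no_slip R u"
      then have cu: "continuous_on ({0<..} \<times> Cl) (\<lambda>(t, x). u t x)"
        and u0: "\<And>x. x \<in> frontier R \<Longrightarrow> u t x = 0"
        using t by (auto simp: no_slip_def closure_R)
      have cut: "continuous_on Cl (\<lambda>x. u t x $ l)" for l
        by (intro continuous_intros continuous_on_compose2[OF cu, of Cl "\<lambda>x. (t, x)", simplified])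
          (use t in auto)
      show ?thesis
        by (intro conjI allI matched_extendable_frontier poincare_no_slip extendable_power2 cut u p(1))
          (auto simp: u0)
    next
      assume smooth': "smooth_perturbation i j UNIV u p"
        and "periodic_zero_mean (b\<^sub>i - a\<^sub>i) (b\<^sub>j - a\<^sub>j) R u p"
      then have per: "u t (x + (b\<^sub>i - a\<^sub>i, 0)) = u t x" "u t (x + (0, b\<^sub>j - a\<^sub>j)) = u t x"
          "p t (x + (b\<^sub>i - a\<^sub>i, 0)) = p t x" "p t (x + (0, b\<^sub>j - a\<^sub>j)) = p t x"
        and mean: "(LINT x:R|lborel. u t x) = 0" for x
        using t unfolding periodic_zero_mean_def by blast+
      have Ck_u': "Ck_closure (Suc 1) i j UNIV (\<lambda>t x. u t x $ l)" for l
        using smooth' by (simp add: smooth_perturbation_def numeral_2_eq_2)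
      have Ck_p': "Ck_closure (Suc 0) i j UNIV p"
        using smooth' by (simp add: smooth_perturbation_def)
      note cu = Ck_closure_slice(1,2)[OF Ck_u' t, unfolded extendable_UNIV]
      note cp = Ck_closure_slice(1)[OF Ck_p' t, unfolded extendable_UNIV]
      have pd_per: "pd i j n (\<lambda>y. u t y $ l) (x + (b\<^sub>i - a\<^sub>i, 0)) = pd i j n (\<lambda>y. u t y $ l) x"
          "pd i j n (\<lambda>y. u t y $ l) (x + (0, b\<^sub>j - a\<^sub>j)) = pd i j n (\<lambda>y. u t y $ l) x" for n l x
        by (rule pd_periodic, simp add: per)+
      \<comment> \<open>The zero mean is given for the vector-valued integral. Integrability of the
        vector field is what allows passing to its components.\<close>
      have "continuous_on UNIV (u t)"
        using continuous_on_vec_lambda[of UNIV "\<lambda>l x. u t x $ l", OF cu(1)] by simp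
      then have "extendable R (u t)"
        by (rule extendable_continuous[OF continuous_on_subset]) simp
      then have "integral R (\<lambda>x. u t x $ l) = 0" for l
        using integral_component_eq_cart[OF extendable_integrable(1), of "u t" l] LINT_R[of "u t"] mean by simp
      then show ?thesis
        by (intro conjI allI matched_extendable_periodic poincare_periodic continuous_intros cu cp
            Ck_closure_slice(3)[OF Ck_u' t]) (auto simp: per pd_per)
    qed
    have model: "?w l x = 1 / Rey * laplacian i j (\<lambda>y. u t y $ l) x
               - (\<Sum>n\<in>UNIV. u t x $ n * pd i j n (\<lambda>y. u t y $ l) x)
               - (\<Sum>n\<in>UNIV. U x $ n * pd i j n (\<lambda>y. u t y $ l) x)
               - (\<Sum>n\<in>UNIV. u t x $ n * pd i j n (\<lambda>y. U y $ l) x)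
               - pd i j l (p t) x
               + (\<Sum>n\<in>UNIV. F $ l $ n * u t x $ n)
               + d t x $ l"
      and div: "(\<Sum>n\<in>UNIV. pd i j n (\<lambda>y. u t y $ n) x) = 0" if "x \<in> R" for l x
      using assms(10) t that unfolding perturbation_model_def \<Omega> by blast+
    have "(\<Sum>l\<in>UNIV. k $ l * integral R (\<lambda>x. u t x $ l * ?w l x)) \<le>
      - (\<Sum>l\<in>UNIV. k $ l * integral R (\<lambda>x.
            poincare_const R / Rey * (u t x $ l)^2
            + (\<Sum>n\<in>UNIV. U x $ n * u t x $ l * pd i j n (\<lambda>y. u t y $ l) x)
            + (\<Sum>n\<in>UNIV. u t x $ n * u t x $ l * pd i j n (\<lambda>y. U y $ l) x)
            - (\<Sum>n\<in>UNIV. u t x $ l * F $ l $ n * u t x $ n)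
            - u t x $ l * d t x $ l))"
      by (rule energy_estimate[where v = "\<lambda>l y. u t y $ l" and U = "\<lambda>l y. U y $ l" and q = "p t"
            and g = "\<lambda>l y. d t y $ l" and w = ?w])
        (use bc model div assms(6,12,13) in \<open>blast intro: u pdu p U d\<close>)+
    then show "(\<Sum>l\<in>UNIV. k $ l * integral R (\<lambda>x. u t x $ l * ?w l x)) \<le>
      - (\<Sum>l\<in>UNIV. k $ l * (LINT x:R|lborel.
            poincare_const R / Rey * (u t x $ l)^2
            + (\<Sum>n\<in>UNIV. U x $ n * u t x $ l * pd i j n (\<lambda>y. u t y $ l) x)
            + (\<Sum>n\<in>UNIV. u t x $ n * u t x $ l * pd i j n (\<lambda>y. U y $ l) x)
            - (\<Sum>n\<in>UNIV. u t x $ l * F $ l $ n * u t x $ n)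
            - u t x $ l * d t x $ l))"
      by (subst LINT_R) (intro extendable_intros u U d; assumption?)+
  qed
  then show ?thesis
    unfolding \<Omega> using poincare_const_pos by blast
qed

end
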